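(* Let $R$ be a ring, $\sigma$ an endomorphism of $R$ and $\delta$ a $\sigma$-derivation of $R$. Suppose that $R$ is $(\sigma,\delta)$-skew Armendariz and satisfies the condition $(\mathcal{C}_{\sigma})$. Then the following statements are equivalent: (1) $R$ is reversible; (2) $R$ is $\sigma$-reversible; (3) $R$ is right $\sigma$-reversible; (4) $R[x;\sigma,\delta]$ is reversible.
   Context: Rings are associative with unity, not necessarily commutative. $\sigma$ is a ring endomorphism of $R$. A $\sigma$-derivation is an additive map $\delta:R\to R$ with $\delta(ab)=\sigma(a)\delta(b)+\delta(a)b$ for all $a,b\in R$. The Ore extension $R[x;\sigma,\delta]$ consists of polynomials $\sum a_i x^i$ with coefficients in $R$ written on the left, with usual addition and multiplication determined by $xa=\sigma(a)x+\delta(a)$ for $a\in R$. Condition $(\mathcal{C}_{\sigma})$: whenever $a\sigma(b)=0$ with $a,b\in R$, then $ab=0$. $R$ is $(\sigma,\delta)$-skew Armendariz if for all $p=\sum_{i=0}^{n}a_ix^i$ and $q=\sum_{j=0}^{m}b_jx^j$ in $R[x;\sigma,\delta]$, $pq=0$ implies $a_ix^ib_jx^j=0$ (in $R[x;\sigma,\delta]$) for all $i,j$. A ring $S$ is reversible if $ab=0$ implies $ba=0$ for all $a,b\in S$. $R$ is right (respectively, left) $\sigma$-reversible if whenever $ab=0$ for $a,b\in R$, then $b\sigma(a)=0$ (respectively, $\sigma(b)a=0$). $R$ is $\sigma$-reversible if it is both right and left $\sigma$-reversible. *)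

theory Defs
  imports "HOL-Algebra.UnivPoly"
begin

locale sigma_derivation = ring R for R (structure) +
  fixes \<sigma> \<delta> :: "'a \<Rightarrow> 'a"
  assumes endo: "\<sigma> \<in> ring_hom R R"
    and deriv_closed: "a \<in> carrier R \<Longrightarrow> \<delta> a \<in> carrier R"
    and deriv_add: "a \<in> carrier R \<Longrightarrow> b \<in> carrier R \<Longrightarrow> \<delta> (a \<oplus> b) = \<delta> a \<oplus> \<delta> b"
    and deriv_mult:
      "a \<in> carrier R \<Longrightarrow> b \<in> carrier R \<Longrightarrow> \<delta> (a \<otimes> b) = \<sigma> a \<otimes> \<delta> b \<oplus> \<delta> a \<otimes> b"

text \<open>
  A polynomial is the sequence of its left coefficients, as in \<^const>\<open>UP\<close>. Left
  multiplication by \<open>x\<close> is forced by \<open>x a = \<sigma>(a) x + \<delta>(a)\<close>: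
  \<open>x (\<Sum> b\<^sub>j x\<^sup>j) = \<Sum> (\<sigma>(b\<^sub>j) x + \<delta>(b\<^sub>j)) x\<^sup>j\<close>.
\<close>

definition ore_var_mult ::
    "('a, 'm) ring_scheme \<Rightarrow> ('a \<Rightarrow> 'a) \<Rightarrow> ('a \<Rightarrow> 'a) \<Rightarrow> (nat \<Rightarrow> 'a) \<Rightarrow> nat \<Rightarrow> 'a"
  where "ore_var_mult R \<sigma> \<delta> q =
    (\<lambda>n. (case n of 0 \<Rightarrow> \<zero>\<^bsub>R\<^esub> | Suc m \<Rightarrow> \<sigma> (q m)) \<oplus>\<^bsub>R\<^esub> \<delta> (q n))"

text \<open>
  The additive structure of the Ore extension \<open>R[x;\<sigma>,\<delta>]\<close>, and left multiplication by elements of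
  \<open>R\<close>, are those of the ordinary polynomials \<^term>\<open>UP R\<close>;
  the product is \<open>(\<Sum> a\<^sub>i x\<^sup>i) q = \<Sum> a\<^sub>i (x\<^sup>i q)\<close>.
\<close>

definition ore_ext ::
    "('a, 'm) ring_scheme \<Rightarrow> ('a \<Rightarrow> 'a) \<Rightarrow> ('a \<Rightarrow> 'a) \<Rightarrow> (nat \<Rightarrow> 'a) ring"
  where "ore_ext R \<sigma> \<delta> = \<lparr>
    carrier = carrier (UP R),
    mult = (\<lambda>p q. \<Oplus>\<^bsub>UP R\<^esub>i \<in> {..deg R p}. p i \<odot>\<^bsub>UP R\<^esub> (ore_var_mult R \<sigma> \<delta> ^^ i) q),
    one = \<one>\<^bsub>UP R\<^esub>,
    zero = \<zero>\<^bsub>UP R\<^esub>,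
    add = add (UP R)\<rparr>"

text \<open>
  With this product the polynomials form a ring containing \<open>R\<close> (as the constants) in which
  \<open>x a = \<sigma>(a) x + \<delta>(a)\<close>.
\<close>

context sigma_derivation
begin

lemma endo_closed [simp]: "a \<in> carrier R \<Longrightarrow> \<sigma> a \<in> carrier R"
  using endo by (rule ring_hom_closed)

lemma endo_add: "a \<in> carrier R \<Longrightarrow> b \<in> carrier R \<Longrightarrow> \<sigma> (a \<oplus> b) = \<sigma> a \<oplus> \<sigma> b"
  using endo by (rule ring_hom_add)

lemma endo_mult: "a \<in> carrier R \<Longrightarrow> b \<in> carrier R \<Longrightarrow> \<sigma> (a \<otimes> b) = \<sigma> a \<otimes> \<sigma> b"
  using endo by (rule ring_hom_mult)

lemma endo_one [simp]: "\<sigma> \<one> = \<one>"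
  using endo by (rule ring_hom_one)

lemma endo_zero [simp]: "\<sigma> \<zero> = \<zero>"
  using ring_hom_zero[OF endo ring_axioms ring_axioms] .

lemma deriv_zero [simp]: "\<delta> \<zero> = \<zero>"
proof -
  have "\<delta> \<zero> \<oplus> \<delta> \<zero> = \<delta> \<zero>"
    using deriv_add[of \<zero> \<zero>] deriv_closed[of \<zero>] by simp
  then show ?thesis
    using deriv_closed[of \<zero>] by (simp add: add.l_cancel_one)
qed

lemma deriv_one [simp]: "\<delta> \<one> = \<zero>"
proof -
  have "\<delta> \<one> \<oplus> \<delta> \<one> = \<delta> \<one>"
    using deriv_mult[of \<one> \<one>] deriv_closed[of \<one>] by simp
  then show ?thesis
    using deriv_closed[of \<one>] by (simp add: add.l_cancel_one)
qed

lemmas R_ac = a_ac r_distr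
lemmas R_r_null = r_null

interpretation UP_ring R "UP R"
  by (simp add: UP_ring_def ring_axioms)

interpretation P: ring "UP R"
  by (rule UP_ring)

abbreviation X where "X \<equiv> ore_var_mult R \<sigma> \<delta>"
abbreviation S where "S \<equiv> ore_ext R \<sigma> \<delta>"

lemma coeff_apply: "p \<in> carrier (UP R) \<Longrightarrow> coeff (UP R) p = p"
  by (simp add: UP_def)

lemma coeff_X: "X p n = (case n of 0 \<Rightarrow> \<zero> | Suc m \<Rightarrow> \<sigma> (p m)) \<oplus> \<delta> (p n)"
  by (simp add: ore_var_mult_def)

lemma apply_closed [simp]: "p \<in> carrier (UP R) \<Longrightarrow> p n \<in> carrier R"
  using coeff_closed[of p n] by (simp add: coeff_apply)

lemma X_closed [simp]:
  assumes "p \<in> carrier (UP R)" shows "X p \<in> carrier (UP R)"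
proof -
  obtain n where n: "bound \<zero> n p" using assms by (auto simp: UP_def)
  have "bound \<zero> (Suc n) (X p)"
  proof
    fix m assume "Suc n < m"
    then show "X p m = \<zero>" using n by (cases m) (auto simp: coeff_X bound_def)
  qed
  moreover have "X p m \<in> carrier R" for m
    using assms by (cases m) (auto simp: coeff_X deriv_closed)
  ultimately show ?thesis by (auto simp: UP_def)
qed

lemma Xn_closed [simp]: "p \<in> carrier (UP R) \<Longrightarrow> (X ^^ n) p \<in> carrier (UP R)"
  by (induction n) auto

lemma UP_add_apply:
  "p \<in> carrier (UP R) \<Longrightarrow> q \<in> carrier (UP R) \<Longrightarrow> (p \<oplus>\<^bsub>UP R\<^esub> q) n = p n \<oplus> q n"
  using coeff_add[of p q n] by (simp add: coeff_apply)

lemma UP_smult_apply: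
  "a \<in> carrier R \<Longrightarrow> p \<in> carrier (UP R) \<Longrightarrow> (a \<odot>\<^bsub>UP R\<^esub> p) n = a \<otimes> p n"
  using coeff_smult[of a p n] by (simp add: coeff_apply)

lemma UP_zero_apply: "\<zero>\<^bsub>UP R\<^esub> n = \<zero>"
  by (simp add: UP_def)

lemma X_add:
  assumes "p \<in> carrier (UP R)" "q \<in> carrier (UP R)"
  shows "X (p \<oplus>\<^bsub>UP R\<^esub> q) = X p \<oplus>\<^bsub>UP R\<^esub> X q"
proof
  fix n show "X (p \<oplus>\<^bsub>UP R\<^esub> q) n = (X p \<oplus>\<^bsub>UP R\<^esub> X q) n"
    using assms
    by (cases n) (simp_all add: UP_add_apply coeff_X endo_add deriv_add deriv_closed R_ac)
qed

lemma Xn_add: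
  "p \<in> carrier (UP R) \<Longrightarrow> q \<in> carrier (UP R) \<Longrightarrow>
    (X ^^ n) (p \<oplus>\<^bsub>UP R\<^esub> q) = (X ^^ n) p \<oplus>\<^bsub>UP R\<^esub> (X ^^ n) q"
  by (induction n) (auto simp: X_add)

lemma X_zero [simp]: "X \<zero>\<^bsub>UP R\<^esub> = \<zero>\<^bsub>UP R\<^esub>"
  by (rule ext) (simp add: coeff_X UP_zero_apply split: nat.split)

lemma X_smult:
  assumes "a \<in> carrier R" "p \<in> carrier (UP R)"
  shows "X (a \<odot>\<^bsub>UP R\<^esub> p) = \<sigma> a \<odot>\<^bsub>UP R\<^esub> X p \<oplus>\<^bsub>UP R\<^esub> \<delta> a \<odot>\<^bsub>UP R\<^esub> p"
proof
  fix n show "X (a \<odot>\<^bsub>UP R\<^esub> p) n = (\<sigma> a \<odot>\<^bsub>UP R\<^esub> X p \<oplus>\<^bsub>UP R\<^esub> \<delta> a \<odot>\<^bsub>UP R\<^esub> p) n"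
    using assms
    by (cases n)
      (simp_all add: UP_add_apply UP_smult_apply coeff_X endo_mult deriv_mult deriv_closed
        R_ac)
qed

lemma X_finsum:
  "finite A \<Longrightarrow> f \<in> A \<rightarrow> carrier (UP R) \<Longrightarrow>
    X (\<Oplus>\<^bsub>UP R\<^esub>i\<in>A. f i) = (\<Oplus>\<^bsub>UP R\<^esub>i\<in>A. X (f i))"
  by (induction A rule: finite_induct) (auto simp: P.finsum_insert X_add Pi_def)

lemma smult_finsum:
  "finite A \<Longrightarrow> a \<in> carrier R \<Longrightarrow> f \<in> A \<rightarrow> carrier (UP R) \<Longrightarrow>
    a \<odot>\<^bsub>UP R\<^esub> (\<Oplus>\<^bsub>UP R\<^esub>i\<in>A. f i) = (\<Oplus>\<^bsub>UP R\<^esub>i\<in>A. a \<odot>\<^bsub>UP R\<^esub> f i)"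
proof (induction A rule: finite_induct)
  case empty
  then show ?case
    using UP_smult_apply[OF _ P.zero_closed, of a] R_r_null[of a]
    by (intro ext) (simp only: P.finsum_empty, metis UP_zero_apply)
next
  case (insert x F)
  then show ?case by (auto simp: P.finsum_insert UP_smult_r_distr Pi_def)
qed

lemma ore_carrier [simp]: "carrier S = carrier (UP R)"
  and ore_zero [simp]: "\<zero>\<^bsub>S\<^esub> = \<zero>\<^bsub>UP R\<^esub>"
  and ore_one [simp]: "\<one>\<^bsub>S\<^esub> = \<one>\<^bsub>UP R\<^esub>"
  and ore_add [simp]: "p \<oplus>\<^bsub>S\<^esub> q = p \<oplus>\<^bsub>UP R\<^esub> q"
  by (simp_all add: ore_ext_def)

lemma ore_mult_le:
  assumes p: "p \<in> carrier (UP R)" and q: "q \<in> carrier (UP R)" and n: "deg R p \<le> n"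
  shows "p \<otimes>\<^bsub>S\<^esub> q = (\<Oplus>\<^bsub>UP R\<^esub>i\<in>{..n}. p i \<odot>\<^bsub>UP R\<^esub> (X ^^ i) q)"
proof -
  have *: "p i \<odot>\<^bsub>UP R\<^esub> (X ^^ i) q = \<zero>\<^bsub>UP R\<^esub>" if "deg R p < i" for i
    using deg_aboveD[OF that p] p q by (simp add: coeff_apply)
  have "(\<Oplus>\<^bsub>UP R\<^esub>i\<in>{..n}. p i \<odot>\<^bsub>UP R\<^esub> (X ^^ i) q)
      = (\<Oplus>\<^bsub>UP R\<^esub>i\<in>{..deg R p} \<union> {deg R p<..n}. p i \<odot>\<^bsub>UP R\<^esub> (X ^^ i) q)"
    using n by (simp only: ivl_disj_un_one)
  also have "\<dots> = (\<Oplus>\<^bsub>UP R\<^esub>i\<in>{..deg R p}. p i \<odot>\<^bsub>UP R\<^esub> (X ^^ i) q)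
      \<oplus>\<^bsub>UP R\<^esub> (\<Oplus>\<^bsub>UP R\<^esub>i\<in>{deg R p<..n}. p i \<odot>\<^bsub>UP R\<^esub> (X ^^ i) q)"
    using p q by (intro P.finsum_Un_disjoint) auto
  also have "(\<Oplus>\<^bsub>UP R\<^esub>i\<in>{deg R p<..n}. p i \<odot>\<^bsub>UP R\<^esub> (X ^^ i) q)
      = (\<Oplus>\<^bsub>UP R\<^esub>i\<in>{deg R p<..n}. \<zero>\<^bsub>UP R\<^esub>)"
    using * by (intro P.finsum_cong') auto
  finally show ?thesis
    using p q by (simp add: ore_ext_def P.finsum_zero Pi_def)
qed

lemma ore_mult_closed [simp]:
  "p \<in> carrier (UP R) \<Longrightarrow> q \<in> carrier (UP R) \<Longrightarrow> p \<otimes>\<^bsub>S\<^esub> q \<in> carrier (UP R)"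
  by (simp add: ore_ext_def Pi_def)

lemma ore_l_distr:
  assumes "p \<in> carrier (UP R)" "q \<in> carrier (UP R)" "r \<in> carrier (UP R)"
  shows "(p \<oplus>\<^bsub>UP R\<^esub> q) \<otimes>\<^bsub>S\<^esub> r = p \<otimes>\<^bsub>S\<^esub> r \<oplus>\<^bsub>UP R\<^esub> q \<otimes>\<^bsub>S\<^esub> r"
proof -
  define n where "n = max (deg R p) (deg R q)"
  have n: "deg R p \<le> n" "deg R q \<le> n" "deg R (p \<oplus>\<^bsub>UP R\<^esub> q) \<le> n"
    using deg_add assms by (auto simp: n_def)
  have "(p \<oplus>\<^bsub>UP R\<^esub> q) \<otimes>\<^bsub>S\<^esub> r = (\<Oplus>\<^bsub>UP R\<^esub>i\<in>{..n}. p i \<odot>\<^bsub>UP R\<^esub> (X ^^ i) r \<oplus>\<^bsub>UP R\<^esub> q i \<odot>\<^bsub>UP R\<^esub> (X ^^ i) r)"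
    unfolding ore_mult_le[OF P.a_closed[OF assms(1,2)] assms(3) n(3)]
    using assms by (intro P.finsum_cong') (auto simp: UP_add_apply UP_smult_l_distr)
  also have "\<dots> = p \<otimes>\<^bsub>S\<^esub> r \<oplus>\<^bsub>UP R\<^esub> q \<otimes>\<^bsub>S\<^esub> r"
    using assms n by (simp add: ore_mult_le P.finsum_addf Pi_def)
  finally show ?thesis .
qed

lemma ore_r_distr:
  assumes "p \<in> carrier (UP R)" "q \<in> carrier (UP R)" "r \<in> carrier (UP R)"
  shows "r \<otimes>\<^bsub>S\<^esub> (p \<oplus>\<^bsub>UP R\<^esub> q) = r \<otimes>\<^bsub>S\<^esub> p \<oplus>\<^bsub>UP R\<^esub> r \<otimes>\<^bsub>S\<^esub> q"
  using assms
  by (simp add: ore_ext_def Xn_add UP_smult_r_distr P.finsum_addf Pi_def)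

lemma ore_zero_mult: "q \<in> carrier (UP R) \<Longrightarrow> \<zero>\<^bsub>UP R\<^esub> \<otimes>\<^bsub>S\<^esub> q = \<zero>\<^bsub>UP R\<^esub>"
  by (simp add: ore_ext_def UP_zero_apply Pi_def P.finsum_zero)

lemma ore_finsum_mult:
  "finite A \<Longrightarrow> f \<in> A \<rightarrow> carrier (UP R) \<Longrightarrow> q \<in> carrier (UP R) \<Longrightarrow>
    (\<Oplus>\<^bsub>UP R\<^esub>i\<in>A. f i) \<otimes>\<^bsub>S\<^esub> q = (\<Oplus>\<^bsub>UP R\<^esub>i\<in>A. f i \<otimes>\<^bsub>S\<^esub> q)"
  by (induction A rule: finite_induct)
    (auto simp: P.finsum_insert ore_l_distr ore_zero_mult Pi_def)

lemma ore_smult_mult: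
  assumes "a \<in> carrier R" "p \<in> carrier (UP R)" "q \<in> carrier (UP R)"
  shows "(a \<odot>\<^bsub>UP R\<^esub> p) \<otimes>\<^bsub>S\<^esub> q = a \<odot>\<^bsub>UP R\<^esub> (p \<otimes>\<^bsub>S\<^esub> q)"
proof -
  have "deg R (a \<odot>\<^bsub>UP R\<^esub> p) \<le> deg R p"
    using assms by (intro deg_aboveI) (auto simp: deg_aboveD)
  then have "(a \<odot>\<^bsub>UP R\<^esub> p) \<otimes>\<^bsub>S\<^esub> q
      = (\<Oplus>\<^bsub>UP R\<^esub>i\<in>{..deg R p}. a \<odot>\<^bsub>UP R\<^esub> (p i \<odot>\<^bsub>UP R\<^esub> (X ^^ i) q))"
    unfolding ore_mult_le[OF UP_smult_closed[OF assms(1,2)] assms(3) \<open>deg R (a \<odot>\<^bsub>UP R\<^esub> p) \<le> deg R p\<close>]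
    using assms by (intro P.finsum_cong') (auto simp: UP_smult_apply UP_smult_assoc1)
  then show ?thesis
    using assms by (simp add: ore_mult_le[OF _ _ order_refl] smult_finsum Pi_def)
qed

lemma X_mult:
  assumes p: "p \<in> carrier (UP R)" and q: "q \<in> carrier (UP R)"
  shows "X p \<otimes>\<^bsub>S\<^esub> q = X (p \<otimes>\<^bsub>S\<^esub> q)"
proof -
  define n where "n = deg R p"
  have p0: "p i = \<zero>" if "n < i" for i
    using deg_aboveD[OF _ p, of i] that p by (simp add: coeff_apply n_def)
  have "deg R (X p) \<le> Suc n"
  proof (rule deg_aboveI)
    fix m assume "Suc n < m"
    then show "coeff (UP R) (X p) m = \<zero>"
      using p p0 by (cases m) (simp_all add: coeff_apply coeff_X)
  qed (use p in simp)
  let ?c = "\<lambda>i. case i of 0 \<Rightarrow> \<zero> | Suc m \<Rightarrow> \<sigma> (p m)"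
  let ?Y = "\<lambda>i. (X ^^ i) q"
  have c: "?c i \<in> carrier R" for i using p by (cases i) auto
  have "X p \<otimes>\<^bsub>S\<^esub> q = (\<Oplus>\<^bsub>UP R\<^esub>i\<in>{..Suc n}. ?c i \<odot>\<^bsub>UP R\<^esub> ?Y i \<oplus>\<^bsub>UP R\<^esub> \<delta> (p i) \<odot>\<^bsub>UP R\<^esub> ?Y i)"
    unfolding ore_mult_le[OF X_closed[OF p] q \<open>deg R (X p) \<le> Suc n\<close>]
    using p q c by (intro P.finsum_cong') (auto simp: coeff_X UP_smult_l_distr deriv_closed)
  also have "\<dots> = (\<Oplus>\<^bsub>UP R\<^esub>i\<in>{..Suc n}. ?c i \<odot>\<^bsub>UP R\<^esub> ?Y i)
      \<oplus>\<^bsub>UP R\<^esub> (\<Oplus>\<^bsub>UP R\<^esub>i\<in>{..Suc n}. \<delta> (p i) \<odot>\<^bsub>UP R\<^esub> ?Y i)"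
    using p q c by (intro P.finsum_addf) (auto simp: deriv_closed)
  also have "(\<Oplus>\<^bsub>UP R\<^esub>i\<in>{..Suc n}. ?c i \<odot>\<^bsub>UP R\<^esub> ?Y i)
      = (\<Oplus>\<^bsub>UP R\<^esub>i\<in>{..n}. \<sigma> (p i) \<odot>\<^bsub>UP R\<^esub> X (?Y i))"
    using p q c by (subst P.finsum_Suc2) (auto simp: Pi_def)
  also have "(\<Oplus>\<^bsub>UP R\<^esub>i\<in>{..Suc n}. \<delta> (p i) \<odot>\<^bsub>UP R\<^esub> ?Y i)
      = (\<Oplus>\<^bsub>UP R\<^esub>i\<in>{..n}. \<delta> (p i) \<odot>\<^bsub>UP R\<^esub> ?Y i)"
    using p q by (subst P.finsum_Suc) (auto simp: Pi_def deriv_closed p0)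
  also have "(\<Oplus>\<^bsub>UP R\<^esub>i\<in>{..n}. \<sigma> (p i) \<odot>\<^bsub>UP R\<^esub> X (?Y i))
      \<oplus>\<^bsub>UP R\<^esub> (\<Oplus>\<^bsub>UP R\<^esub>i\<in>{..n}. \<delta> (p i) \<odot>\<^bsub>UP R\<^esub> ?Y i)
      = (\<Oplus>\<^bsub>UP R\<^esub>i\<in>{..n}. X (p i \<odot>\<^bsub>UP R\<^esub> ?Y i))"
    using p q
    by (subst P.finsum_addf[symmetric])
      (auto simp: X_smult deriv_closed simp del: P.finsum_addf intro!: P.finsum_cong')
  also have "\<dots> = X (p \<otimes>\<^bsub>S\<^esub> q)"
    using p q by (simp add: ore_mult_le[OF _ _ order_refl] n_def X_finsum Pi_def)
  finally show ?thesis .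
qed

lemma Xn_mult:
  "p \<in> carrier (UP R) \<Longrightarrow> q \<in> carrier (UP R) \<Longrightarrow> (X ^^ n) p \<otimes>\<^bsub>S\<^esub> q = (X ^^ n) (p \<otimes>\<^bsub>S\<^esub> q)"
  by (induction n) (auto simp: X_mult)

lemma ore_assoc:
  assumes "p \<in> carrier (UP R)" "q \<in> carrier (UP R)" "r \<in> carrier (UP R)"
  shows "(p \<otimes>\<^bsub>S\<^esub> q) \<otimes>\<^bsub>S\<^esub> r = p \<otimes>\<^bsub>S\<^esub> (q \<otimes>\<^bsub>S\<^esub> r)"
proof -
  have "(p \<otimes>\<^bsub>S\<^esub> q) \<otimes>\<^bsub>S\<^esub> r = (\<Oplus>\<^bsub>UP R\<^esub>i\<in>{..deg R p}. (p i \<odot>\<^bsub>UP R\<^esub> (X ^^ i) q) \<otimes>\<^bsub>S\<^esub> r)"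
    unfolding ore_mult_le[OF assms(1,2) order_refl]
    using assms by (intro ore_finsum_mult) auto
  also have "\<dots> = (\<Oplus>\<^bsub>UP R\<^esub>i\<in>{..deg R p}. p i \<odot>\<^bsub>UP R\<^esub> (X ^^ i) (q \<otimes>\<^bsub>S\<^esub> r))"
    using assms by (intro P.finsum_cong') (auto simp: ore_smult_mult Xn_mult)
  also have "\<dots> = p \<otimes>\<^bsub>S\<^esub> (q \<otimes>\<^bsub>S\<^esub> r)"
    using assms by (simp add: ore_mult_le[OF _ _ order_refl])
  finally show ?thesis .
qed

lemma Xn_one: "(X ^^ n) \<one>\<^bsub>UP R\<^esub> = monom (UP R) \<one> n"
proof (induction n)
  case (Suc n)
  have "X (monom (UP R) \<one> n) = monom (UP R) \<one> (Suc n)"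
    by (rule ext) (auto simp: coeff_X UP_def split: nat.split)
  with Suc show ?case by simp
qed simp

lemma ore_one_mult: "q \<in> carrier (UP R) \<Longrightarrow> \<one>\<^bsub>UP R\<^esub> \<otimes>\<^bsub>S\<^esub> q = q"
  using coeff_one[of 0] by (simp add: ore_ext_def coeff_apply Pi_def del: coeff_one)

lemma ore_mult_one:
  assumes "p \<in> carrier (UP R)" shows "p \<otimes>\<^bsub>S\<^esub> \<one>\<^bsub>UP R\<^esub> = p"
proof -
  have "p \<otimes>\<^bsub>S\<^esub> \<one>\<^bsub>UP R\<^esub> = (\<Oplus>\<^bsub>UP R\<^esub>i\<in>{..deg R p}. monom (UP R) (coeff (UP R) p i) i)"
    unfolding ore_mult_le[OF assms P.one_closed order_refl]
    using assms
    by (intro P.finsum_cong') (auto simp: Xn_one coeff_apply monom_mult_smult[symmetric])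
  then show ?thesis using up_repr[OF assms] by simp
qed

theorem ring_ore_ext: "ring S"
proof (rule ringI)
  show "abelian_group S"
    using P.a_assoc P.a_comm P.l_neg
    by (intro abelian_groupI) (auto intro!: bexI[of _ "\<ominus>\<^bsub>UP R\<^esub> _"] P.l_neg simp: P.a_ac)
  show "Group.monoid S"
    by (rule monoidI) (auto simp: ore_assoc ore_one_mult ore_mult_one)
qed (auto simp: ore_l_distr ore_r_distr)

theorem ore_const_mult:
  assumes "a \<in> carrier R" "q \<in> carrier (UP R)"
  shows "monom (UP R) a 0 \<otimes>\<^bsub>S\<^esub> q = a \<odot>\<^bsub>UP R\<^esub> q"
proof -
  have "monom (UP R) a 0 \<otimes>\<^bsub>S\<^esub> q = (a \<odot>\<^bsub>UP R\<^esub> \<one>\<^bsub>UP R\<^esub>) \<otimes>\<^bsub>S\<^esub> q"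
    using monom_mult_smult[of a \<one> 0] assms by simp
  then show ?thesis
    using assms by (simp add: ore_smult_mult ore_one_mult)
qed

theorem ore_monom:
  assumes "a \<in> carrier R"
  shows "monom (UP R) a n = monom (UP R) a 0 \<otimes>\<^bsub>S\<^esub> (monom (UP R) \<one> 1 [^]\<^bsub>S\<^esub> n)"
proof -
  interpret S: ring S by (rule ring_ore_ext)
  have x: "monom (UP R) \<one> 1 = X \<one>\<^bsub>UP R\<^esub>"
    using Xn_one[of 1] by simp
  have "monom (UP R) \<one> 1 [^]\<^bsub>S\<^esub> n = monom (UP R) \<one> n"
  proof (induction n)
    case 0
    then show ?case by (simp only: S.nat_pow_0 ore_one monom_one)
  next
    case (Suc n)
    have "monom (UP R) \<one> 1 [^]\<^bsub>S\<^esub> Suc n = (X ^^ n) \<one>\<^bsub>UP R\<^esub> \<otimes>\<^bsub>S\<^esub> X \<one>\<^bsub>UP R\<^esub>"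
      unfolding S.nat_pow_Suc Suc Xn_one by (simp only: x)
    also have "\<dots> = monom (UP R) \<one> (Suc n)"
      by (simp add: Xn_mult ore_one_mult funpow_swap1 flip: Xn_one)
    finally show ?case .
  qed
  then show ?thesis
    using assms monom_mult_smult[of a \<one> n] by (simp add: ore_const_mult)
qed

theorem ore_commutation:
  assumes "a \<in> carrier R"
  shows "monom (UP R) \<one> 1 \<otimes>\<^bsub>S\<^esub> monom (UP R) a 0
    = monom (UP R) (\<sigma> a) 0 \<otimes>\<^bsub>S\<^esub> monom (UP R) \<one> 1 \<oplus>\<^bsub>S\<^esub> monom (UP R) (\<delta> a) 0"
proof -
  have x: "monom (UP R) \<one> 1 = X \<one>\<^bsub>UP R\<^esub>"
    using Xn_one[of 1] by simp
  have a: "monom (UP R) b 0 = b \<odot>\<^bsub>UP R\<^esub> \<one>\<^bsub>UP R\<^esub>" if "b \<in> carrier R" for b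
    using monom_mult_smult[of b \<one> 0] that by simp
  have "X \<one>\<^bsub>UP R\<^esub> \<otimes>\<^bsub>S\<^esub> monom (UP R) a 0 = X (a \<odot>\<^bsub>UP R\<^esub> \<one>\<^bsub>UP R\<^esub>)"
    using assms by (simp add: X_mult ore_one_mult a)
  also have "\<dots> = \<sigma> a \<odot>\<^bsub>UP R\<^esub> X \<one>\<^bsub>UP R\<^esub> \<oplus>\<^bsub>UP R\<^esub> \<delta> a \<odot>\<^bsub>UP R\<^esub> \<one>\<^bsub>UP R\<^esub>"
    using assms by (simp add: X_smult)
  finally show ?thesis
    unfolding x[symmetric]
    using assms by (simp add: a[symmetric] ore_const_mult deriv_closed del: One_nat_def)
qed

end

definition C_condition :: "('a, 'm) ring_scheme \<Rightarrow> ('a \<Rightarrow> 'a) \<Rightarrow> bool"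
  where "C_condition R \<sigma> \<longleftrightarrow>
    (\<forall>a \<in> carrier R. \<forall>b \<in> carrier R. a \<otimes>\<^bsub>R\<^esub> \<sigma> b = \<zero>\<^bsub>R\<^esub> \<longrightarrow> a \<otimes>\<^bsub>R\<^esub> b = \<zero>\<^bsub>R\<^esub>)"

definition skew_armendariz :: "('a, 'm) ring_scheme \<Rightarrow> ('a \<Rightarrow> 'a) \<Rightarrow> ('a \<Rightarrow> 'a) \<Rightarrow> bool"
  where "skew_armendariz R \<sigma> \<delta> \<longleftrightarrow>
    (\<forall>p \<in> carrier (ore_ext R \<sigma> \<delta>). \<forall>q \<in> carrier (ore_ext R \<sigma> \<delta>).
      p \<otimes>\<^bsub>ore_ext R \<sigma> \<delta>\<^esub> q = \<zero>\<^bsub>ore_ext R \<sigma> \<delta>\<^esub> \<longrightarrow>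
      (\<forall>i j. monom (UP R) (p i) i \<otimes>\<^bsub>ore_ext R \<sigma> \<delta>\<^esub> monom (UP R) (q j) j
        = \<zero>\<^bsub>ore_ext R \<sigma> \<delta>\<^esub>))"

definition reversible_ring :: "('a, 'm) ring_scheme \<Rightarrow> bool"
  where "reversible_ring S \<longleftrightarrow>
    (\<forall>a \<in> carrier S. \<forall>b \<in> carrier S. a \<otimes>\<^bsub>S\<^esub> b = \<zero>\<^bsub>S\<^esub> \<longrightarrow> b \<otimes>\<^bsub>S\<^esub> a = \<zero>\<^bsub>S\<^esub>)"

definition right_reversible :: "('a, 'm) ring_scheme \<Rightarrow> ('a \<Rightarrow> 'a) \<Rightarrow> bool"
  where "right_reversible R \<sigma> \<longleftrightarrow>
    (\<forall>a \<in> carrier R. \<forall>b \<in> carrier R. a \<otimes>\<^bsub>R\<^esub> b = \<zero>\<^bsub>R\<^esub> \<longrightarrow> b \<otimes>\<^bsub>R\<^esub> \<sigma> a = \<zero>\<^bsub>R\<^esub>)"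

definition left_reversible :: "('a, 'm) ring_scheme \<Rightarrow> ('a \<Rightarrow> 'a) \<Rightarrow> bool"
  where "left_reversible R \<sigma> \<longleftrightarrow>
    (\<forall>a \<in> carrier R. \<forall>b \<in> carrier R. a \<otimes>\<^bsub>R\<^esub> b = \<zero>\<^bsub>R\<^esub> \<longrightarrow> \<sigma> b \<otimes>\<^bsub>R\<^esub> a = \<zero>\<^bsub>R\<^esub>)"

definition endo_reversible :: "('a, 'm) ring_scheme \<Rightarrow> ('a \<Rightarrow> 'a) \<Rightarrow> bool"
  where "endo_reversible R \<sigma> \<longleftrightarrow> right_reversible R \<sigma> \<and> left_reversible R \<sigma>"

end

theory Submission
  imports Defs
begin

text \<open>
  The condition \<open>(\<C>\<^sub>\<sigma>)\<close> has a twisted converse: if \<open>a b = 0\<close>, then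
  \<open>\<sigma>(a) \<sigma>(b) = \<sigma>(a b) = 0\<close>, hence \<open>\<sigma>(a) b = 0\<close> by \<open>(\<C>\<^sub>\<sigma>)\<close>. Together with the freedom to
  exchange factors in a reversible ring, this gives both halves of \<open>\<sigma>\<close>-reversibility. Conversely, right
  \<open>\<sigma>\<close>-reversibility turns \<open>a b = 0\<close> into \<open>b \<sigma>(a) = 0\<close>, and \<open>(\<C>\<^sub>\<sigma>)\<close> removes the \<open>\<sigma>\<close>.

  Reversibility of \<open>R[x;\<sigma>,\<delta>]\<close> restricts to the constants \<open>R\<close>. For the passage from \<open>R\<close> to
  \<open>R[x;\<sigma>,\<delta>]\<close>, the skew Armendariz condition acts twice.
  \<^item> If \<open>p q = 0\<close>, then \<open>a\<^sub>i x\<^sup>i b\<^sub>j x\<^sup>j = 0\<close>, whose coefficient at \<open>x\<^sup>i\<^sup>+\<^sup>j\<close> is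
    \<open>a\<^sub>i \<sigma>\<^sup>i(b\<^sub>j)\<close>; by \<open>(\<C>\<^sub>\<sigma>)\<close>, all the products \<open>a\<^sub>i b\<^sub>j\<close> vanish
    (\<open>armendariz_coeff_mult_zero\<close>).
  \<^item> If \<open>a b = 0\<close>, then \<open>(x a) b = 0\<close>, and \<open>x a = \<sigma>(a) x + \<delta>(a)\<close> has the constant term
    \<open>\<delta>(a)\<close>; hence \<open>\<delta>(a) b = 0\<close> (\<open>armendariz_deriv_mult_zero\<close>).

  When \<open>R\<close> is reversible, the right annihilator of an element \<open>b\<close> is therefore stable under both
  \<open>\<sigma>\<close> and \<open>\<delta>\<close>. If \<open>p q = 0\<close>, then \<open>b\<^sub>j a\<^sub>i = 0\<close> for all \<open>i, j\<close>. The coefficients of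
  \<open>x\<^sup>j p\<close> arise from the \<open>a\<^sub>i\<close> by applying \<open>\<sigma>\<close> and \<open>\<delta>\<close> and adding, so \<open>b\<^sub>j\<close> kills all of them,
  and \<open>q p = \<Sum> b\<^sub>j (x\<^sup>j p) = 0\<close>.
\<close>

context sigma_derivation
begin

interpretation UP_ring R "UP R"
  by (simp add: UP_ring_def ring_axioms)

section \<open>Monomials in the Ore extension\<close>

lemma monom_apply: "a \<in> carrier R \<Longrightarrow> monom (UP R) a i n = (if i = n then a else \<zero>)"
  by (simp add: UP_def)

lemma ore_monom_mult:
  assumes "a \<in> carrier R" "q \<in> carrier (UP R)"
  shows "monom (UP R) a i \<otimes>\<^bsub>S\<^esub> q = a \<odot>\<^bsub>UP R\<^esub> (X ^^ i) q"
proof -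
  have "monom (UP R) a i = a \<odot>\<^bsub>UP R\<^esub> (X ^^ i) \<one>\<^bsub>UP R\<^esub>"
    using monom_mult_smult[of a \<one> i] assms by (simp add: Xn_one)
  then show ?thesis
    using assms by (simp add: ore_smult_mult Xn_mult ore_one_mult)
qed

lemma Xn_monom_above:
  "b \<in> carrier R \<Longrightarrow> i + j < n \<Longrightarrow> (X ^^ i) (monom (UP R) b j) n = \<zero>"
proof (induction i arbitrary: n)
  case (Suc i)
  then show ?case by (cases n) (simp_all add: coeff_X)
qed (simp add: monom_apply)

lemma Xn_monom_top:
  assumes "b \<in> carrier R"
  shows "(X ^^ i) (monom (UP R) b j) (i + j) = (\<sigma> ^^ i) b"
proof (induction i)
  case (Suc i)
  have "(\<sigma> ^^ i) b \<in> carrier R" using assms by (induction i) auto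
  then show ?case
    using Suc Xn_monom_above[OF assms, of i j "Suc (i + j)"]
      coeff_X[of "(X ^^ i) (monom (UP R) b j)" "Suc (i + j)"] by simp
qed (use assms in \<open>simp add: monom_apply\<close>)

lemma ore_const_mult_const:
  assumes "a \<in> carrier R" "b \<in> carrier R"
  shows "monom (UP R) a 0 \<otimes>\<^bsub>S\<^esub> monom (UP R) b 0 = monom (UP R) (a \<otimes> b) 0"
  using assms by (simp add: ore_const_mult monom_mult_smult)

lemma monom_zero_iff:
  "a \<in> carrier R \<Longrightarrow> monom (UP R) a i = \<zero>\<^bsub>UP R\<^esub> \<longleftrightarrow> a = \<zero>"
  using monom_apply[of a i i] UP_zero_apply[of i] by auto

section \<open>Annihilators\<close>

lemma C_condition_funpow:
  assumes "C_condition R \<sigma>" and a: "a \<in> carrier R"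
  shows "b \<in> carrier R \<Longrightarrow> a \<otimes> (\<sigma> ^^ n) b = \<zero> \<Longrightarrow> a \<otimes> b = \<zero>"
proof (induction n arbitrary: b)
  case (Suc n)
  then have "a \<otimes> \<sigma> b = \<zero>" by (simp add: funpow_swap1)
  then show ?case using assms Suc.prems(1) by (simp add: C_condition_def)
qed simp

text \<open>
  Here \<open>\<sigma>\<close> lands on the left factor: multiplicativity puts it on both factors, and \<open>(\<C>\<^sub>\<sigma>)\<close>
  takes it off the right one.
\<close>

lemma C_condition_endo_mult_zero:
  assumes "C_condition R \<sigma>" "a \<in> carrier R" "b \<in> carrier R" "a \<otimes> b = \<zero>"
  shows "\<sigma> a \<otimes> b = \<zero>"
proof -
  have "\<sigma> a \<otimes> \<sigma> b = \<zero>" using assms by (simp flip: endo_mult)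
  then show ?thesis using assms by (simp add: C_condition_def)
qed

text \<open>
  Applied to \<open>x a\<close> and \<open>b\<close>, the Armendariz condition separates \<open>\<delta>(a)\<close>, the constant term of
  \<open>x a\<close>, from \<open>\<sigma>(a) x\<close>.
\<close>

lemma armendariz_deriv_mult_zero:
  assumes arm: "skew_armendariz R \<sigma> \<delta>"
    and a: "a \<in> carrier R" and b: "b \<in> carrier R" and "a \<otimes> b = \<zero>"
  shows "\<delta> a \<otimes> b = \<zero>"
proof -
  let ?p = "X (monom (UP R) a 0)" and ?q = "monom (UP R) b 0"
  have "?p \<otimes>\<^bsub>S\<^esub> ?q = \<zero>\<^bsub>S\<^esub>"
    using assms by (simp add: X_mult ore_const_mult_const)
  then have "monom (UP R) (?p 0) 0 \<otimes>\<^bsub>S\<^esub> monom (UP R) (?q 0) 0 = \<zero>\<^bsub>S\<^esub>"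
    using arm a b unfolding skew_armendariz_def by (metis X_closed monom_closed ore_carrier)
  then show ?thesis
    using a b by (simp add: coeff_X monom_apply deriv_closed ore_const_mult_const monom_zero_iff)
qed

text \<open>
  The Armendariz condition gives \<open>a\<^sub>i x\<^sup>i b\<^sub>j x\<^sup>j = 0\<close>; the coefficient at \<open>x\<^sup>i\<^sup>+\<^sup>j\<close> is the one
  free of \<open>\<delta>\<close>, so that \<open>(\<C>\<^sub>\<sigma>)\<close> applies to it.
\<close>

lemma armendariz_coeff_mult_zero:
  assumes arm: "skew_armendariz R \<sigma> \<delta>" and C: "C_condition R \<sigma>"
    and p: "p \<in> carrier (UP R)" and q: "q \<in> carrier (UP R)" and "p \<otimes>\<^bsub>S\<^esub> q = \<zero>\<^bsub>S\<^esub>"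
  shows "p i \<otimes> q j = \<zero>"
proof -
  have "monom (UP R) (p i) i \<otimes>\<^bsub>S\<^esub> monom (UP R) (q j) j = \<zero>\<^bsub>S\<^esub>"
    using assms by (simp add: skew_armendariz_def)
  then have "p i \<odot>\<^bsub>UP R\<^esub> (X ^^ i) (monom (UP R) (q j) j) = \<zero>\<^bsub>UP R\<^esub>"
    using p q by (simp add: ore_monom_mult)
  then have "p i \<otimes> (X ^^ i) (monom (UP R) (q j) j) (i + j) = \<zero>"
    using p q by (metis UP_smult_apply UP_zero_apply Xn_closed apply_closed monom_closed)
  then have "p i \<otimes> (\<sigma> ^^ i) (q j) = \<zero>"
    using q by (simp add: Xn_monom_top)
  then show ?thesis
    using C_condition_funpow[OF C] p q by simp
qed

text \<open>
  Each coefficient of \<open>x\<^sup>k p\<close> is a sum of words in \<open>\<sigma>\<close> and \<open>\<delta>\<close> applied to coefficients of \<open>p\<close>, so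
  stability of the right annihilator of \<open>c\<close> is all that is needed.
\<close>

lemma mult_Xn_coeff_zero:
  assumes c: "c \<in> carrier R" and p: "p \<in> carrier (UP R)"
    and \<sigma>: "\<And>a. a \<in> carrier R \<Longrightarrow> c \<otimes> a = \<zero> \<Longrightarrow> c \<otimes> \<sigma> a = \<zero>"
    and \<delta>: "\<And>a. a \<in> carrier R \<Longrightarrow> c \<otimes> a = \<zero> \<Longrightarrow> c \<otimes> \<delta> a = \<zero>"
    and cp: "\<And>n. c \<otimes> p n = \<zero>"
  shows "c \<otimes> (X ^^ k) p n = \<zero>"
proof (induction k arbitrary: n)
  case (Suc k)
  have "c \<otimes> \<sigma> ((X ^^ k) p m) = \<zero>" "c \<otimes> \<delta> ((X ^^ k) p m) = \<zero>" for m
    using \<sigma> \<delta> Suc p by simp_all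
  then show ?case
    using c p coeff_X[of "(X ^^ k) p" n] by (cases n) (simp_all add: deriv_closed R_ac)
qed (use cp in simp)

section \<open>Reversibility\<close>

lemma reversible_imp_endo_reversible:
  assumes "C_condition R \<sigma>" "reversible_ring R"
  shows "endo_reversible R \<sigma>"
  using assms C_condition_endo_mult_zero
  unfolding endo_reversible_def right_reversible_def left_reversible_def reversible_ring_def
  by (meson endo_closed)

lemma right_reversible_imp_reversible:
  assumes "C_condition R \<sigma>" "right_reversible R \<sigma>"
  shows "reversible_ring R"
  using assms unfolding C_condition_def right_reversible_def reversible_ring_def by blast

lemma reversible_imp_ore_reversible:
  assumes arm: "skew_armendariz R \<sigma> \<delta>" and C: "C_condition R \<sigma>" and rev: "reversible_ring R"
  shows "reversible_ring S"
proof -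
  have comm: "b \<otimes> a = \<zero>" if "a \<in> carrier R" "b \<in> carrier R" "a \<otimes> b = \<zero>" for a b
    using rev that by (simp add: reversible_ring_def)
  have \<sigma>: "c \<otimes> \<sigma> a = \<zero>" if "c \<in> carrier R" "a \<in> carrier R" "c \<otimes> a = \<zero>" for c a
    using that comm C_condition_endo_mult_zero[OF C] by simp
  have \<delta>: "c \<otimes> \<delta> a = \<zero>" if "c \<in> carrier R" "a \<in> carrier R" "c \<otimes> a = \<zero>" for c a
    using that comm armendariz_deriv_mult_zero[OF arm] by (simp add: deriv_closed)
  have "q \<otimes>\<^bsub>S\<^esub> p = \<zero>\<^bsub>S\<^esub>"
    if p: "p \<in> carrier (UP R)" and q: "q \<in> carrier (UP R)" and pq: "p \<otimes>\<^bsub>S\<^esub> q = \<zero>\<^bsub>S\<^esub>" for p q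
  proof -
    have coeffs: "q j \<otimes> p i = \<zero>" for i j
      using comm armendariz_coeff_mult_zero[OF arm C p q pq] p q by simp
    have "q j \<odot>\<^bsub>UP R\<^esub> (X ^^ j) p = \<zero>\<^bsub>UP R\<^esub>" for j
    proof
      fix n
      have "q j \<otimes> (X ^^ j) p n = \<zero>"
        using mult_Xn_coeff_zero[of "q j" p] p q \<sigma> \<delta> coeffs by simp
      then show "(q j \<odot>\<^bsub>UP R\<^esub> (X ^^ j) p) n = \<zero>\<^bsub>UP R\<^esub> n"
        using p q by (simp add: UP_smult_apply UP_zero_apply)
    qed
    then show ?thesis
      using ore_mult_le[OF q p order_refl] by (simp add: P.finsum_zero)
  qed
  then show ?thesis by (simp add: reversible_ring_def)
qed

lemma ore_reversible_imp_reversible: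
  assumes "reversible_ring S"
  shows "reversible_ring R"
  unfolding reversible_ring_def
proof (intro ballI impI)
  fix a b assume ab: "a \<in> carrier R" "b \<in> carrier R" "a \<otimes> b = \<zero>"
  have "monom (UP R) b 0 \<otimes>\<^bsub>S\<^esub> monom (UP R) a 0 = \<zero>\<^bsub>S\<^esub>"
    using assms ab unfolding reversible_ring_def
    by (simp add: ore_const_mult_const)
  then show "b \<otimes> a = \<zero>"
    using ab by (simp add: ore_const_mult_const monom_zero_iff)
qed

end

theorem theorem3p3:
  fixes R (structure) and \<sigma> \<delta> :: "'a \<Rightarrow> 'a"
  assumes "sigma_derivation R \<sigma> \<delta>"
    and "skew_armendariz R \<sigma> \<delta>"
    and "C_condition R \<sigma>"
  shows "(reversible_ring R \<longleftrightarrow> endo_reversible R \<sigma>)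
    \<and> (endo_reversible R \<sigma> \<longleftrightarrow> right_reversible R \<sigma>)
    \<and> (right_reversible R \<sigma> \<longleftrightarrow> reversible_ring (ore_ext R \<sigma> \<delta>))"
proof -
  interpret sigma_derivation R \<sigma> \<delta> by (rule assms(1))
  have "endo_reversible R \<sigma> \<Longrightarrow> right_reversible R \<sigma>"
    by (simp add: endo_reversible_def)
  then show ?thesis
    using assms(2,3) reversible_imp_endo_reversible right_reversible_imp_reversible
      reversible_imp_ore_reversible ore_reversible_imp_reversible
    by blast
qed

end
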